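(* Let $(U_t)_{t\ge0}$ be a unitary multiplicative monotone increment process (UMIP) in a concrete quantum probability space $(H,\xi)$. Let $$\psi_{st}(z)=\left\langle\xi,\frac{zU_s^*U_t}{1-zU_s^*U_t}\,\xi\right\rangle,\qquad \eta_{st}(z)=\frac{\psi_{st}(z)}{1+\psi_{st}(z)}$$ for $0\le s\le t$ and $|z|<1$, and let $\eta_t=\eta_{0t}$. Then $(\eta_t)_{t\ge0}$ is a multiplicative Loewner chain with transition mappings $(\eta_{st})_{0\le s\le t}$.
   Context: Concrete quantum probability space: a pair $(H,\xi)$ of a complex Hilbert space $H$ (inner product linear in the second argument) and a unit vector $\xi\in H$; $\Phi_\xi(X)=\langle\xi,X\xi\rangle$ for $X\in B(H)$. The distribution of a unitary $U$ is the unique probability measure $\mu$ on $\mathbb T=\{|z|=1\}$ with $\Phi_\xi(U^n)=\int_{\mathbb T}x^n\mu(dx)$, $n\in\mathbb N$. Let $\mathbb D=\{|z|<1\}$. Monotone independence: *-subalgebras $(\mathcal A_\iota)_{\iota\in I}$ of $B(H)$ indexed by a linearly ordered set $I$ are monotonically independent if (i) for all $r,s\ge 0$, $i_1>\cdots>i_r>j<k_s<\cdots<k_1$ in $I$ and $X_p\in\mathcal A_{i_p}$, $Y\in\mathcal A_j$, $Z_q\in\mathcal A_{k_q}$: $\Phi_\xi(X_1\cdots X_rYZ_s\cdots Z_1)=\Phi_\xi(X_1)\cdots\Phi_\xi(X_r)\Phi_\xi(Y)\Phi_\xi(Z_s)\cdots\Phi_\xi(Z_1)$; and (ii) for $i<j>k$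 in $I$, $X\in\mathcal A_i,Y\in\mathcal A_j,Z\in\mathcal A_k$: $XYZ=\Phi_\xi(Y)XZ$. A tuple $(X_1,\dots,X_n)$ of normal operators is monotonically independent if the algebras $\mathcal A_i=\{f(X_i): f\in C_b(\mathbb C), f(0)=0\}$ ($C_b$ = bounded continuous complex functions), $i\in\{1<\dots<n\}$, are. UMIP: a family $(U_t)_{t\ge0}\subset B(H)$ of unitary operators with $U_0=I$ such that (a) $(s,t)\mapsto\mu_{st}$ is weakly continuous, where $\mu_{st}$ is the distribution of $U_s^{-1}U_t$ ($0\le s\le t$); (b) the tuple $(U_{t_1}-I,U_{t_1}^{-1}U_{t_2}-I,\dots,U_{t_{n-1}}^{-1}U_{t_n}-I)$ is monotonically independent for all $n\in\mathbb N$ and $0\le t_1\le\cdots\le t_n$. Multiplicative Loewner chain: a family $(\eta_t)_{t\ge0}=(\eta_{0t})_{t\ge0}$ arising from a family $(\eta_{st})_{0\le s\le t}$ of holomorphic maps $\eta_{st}:\mathbb D\to\mathbb D$ (the transition mappings) with $\eta_{ss}=\mathrm{id}$, $\eta_{su}=\eta_{st}\circ\eta_{tu}$ for $s\le t\le u$, $(s,t)\mapsto\eta_{st}$ continuous with respect to locally uniform convergence, and $\eta_{st}(0)=0$ for all $s\le t$. *)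

theory Defs
  imports "HOL-Complex_Analysis.Complex_Analysis" "HOL-Probability.Probability"
begin

text \<open>The inner product is linear in the second argument.  The norm axiom makes it positive
  definite.\<close>

class complex_inner = real_normed_vector +
  fixes scaleC :: "complex \<Rightarrow> 'a \<Rightarrow> 'a"  (infixr "*\<^sub>C" 75)
    and cinner :: "'a \<Rightarrow> 'a \<Rightarrow> complex"
  assumes scaleC_add_right: "a *\<^sub>C (x + y) = a *\<^sub>C x + a *\<^sub>C y"
    and scaleC_add_left: "(a + b) *\<^sub>C x = a *\<^sub>C x + b *\<^sub>C x"
    and scaleC_scaleC: "a *\<^sub>C (b *\<^sub>C x) = (a * b) *\<^sub>C x"
    and scaleR_scaleC: "r *\<^sub>R x = complex_of_real r *\<^sub>C x"
    and cinner_commute: "cinner x y = cnj (cinner y x)"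
    and cinner_add_right: "cinner x (y + z) = cinner x y + cinner x z"
    and cinner_scaleC_right: "cinner x (a *\<^sub>C y) = a * cinner x y"
    and cinner_self: "cinner x x = complex_of_real ((norm x)\<^sup>2)"

class chilbert_space = complex_inner + complete_space

definition bounded_clinear :: "('h::complex_inner \<Rightarrow> 'h) \<Rightarrow> bool" where
  "bounded_clinear X \<longleftrightarrow> bounded_linear X \<and> (\<forall>a v. X (a *\<^sub>C v) = a *\<^sub>C X v)"

definition cadjoint :: "('h::chilbert_space \<Rightarrow> 'h) \<Rightarrow> 'h \<Rightarrow> 'h" where
  "cadjoint X = (THE Y. \<forall>v w. cinner (Y v) w = cinner v (X w))"

definition unitary_operator :: "('h::chilbert_space \<Rightarrow> 'h) \<Rightarrow> bool" where
  "unitary_operator U \<longleftrightarrow>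
     bounded_clinear U \<and> cadjoint U \<circ> U = id \<and> U \<circ> cadjoint U = id"

definition normal_operator :: "('h::chilbert_space \<Rightarrow> 'h) \<Rightarrow> bool" where
  "normal_operator X \<longleftrightarrow> bounded_clinear X \<and> cadjoint X \<circ> X = X \<circ> cadjoint X"

definition op_spectrum :: "('h::chilbert_space \<Rightarrow> 'h) \<Rightarrow> complex set" where
  "op_spectrum X = {c. \<not> (\<exists>R. bounded_clinear R \<and>
     R \<circ> (\<lambda>v. X v - c *\<^sub>C v) = id \<and> (\<lambda>v. X v - c *\<^sub>C v) \<circ> R = id)}"

definition star_subalgebra :: "('h::chilbert_space \<Rightarrow> 'h) set \<Rightarrow> bool" where
  "star_subalgebra A \<longleftrightarrow> (\<forall>X\<in>A. bounded_clinear X) \<and> (\<lambda>v. 0) \<in> A \<and>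
     (\<forall>X\<in>A. \<forall>Y\<in>A. (\<lambda>v. X v + Y v) \<in> A \<and> X \<circ> Y \<in> A) \<and>
     (\<forall>X\<in>A. cadjoint X \<in> A \<and> (\<forall>c. (\<lambda>v. c *\<^sub>C X v) \<in> A))"

definition star_poly :: "nat \<Rightarrow> (nat \<Rightarrow> nat \<Rightarrow> complex) \<Rightarrow> complex \<Rightarrow> complex" where
  "star_poly d a z = (\<Sum>j\<le>d. \<Sum>k\<le>d. a j k * z ^ j * cnj z ^ k)"

definition star_poly_op ::
    "nat \<Rightarrow> (nat \<Rightarrow> nat \<Rightarrow> complex) \<Rightarrow> ('h::chilbert_space \<Rightarrow> 'h) \<Rightarrow> 'h \<Rightarrow> 'h" where
  "star_poly_op d a X v = (\<Sum>j\<le>d. \<Sum>k\<le>d. a j k *\<^sub>C (X ^^ j) ((cadjoint X ^^ k) v))"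

text \<open>\<open>has_functional_calculus X f Y\<close> reads \<open>f(X) = Y\<close>, for \<open>X\<close> normal and \<open>f\<close> continuous on its
  spectrum: \<open>Y\<close> is the norm limit of polynomials \<open>p\<^sub>n(X, X\<^sup>*)\<close> with \<open>p\<^sub>n(z, cnj z) \<rightarrow> f(z)\<close> uniformly
  on the spectrum.  By the Stone-Weierstrass theorem and
  \<open>\<parallel>p(X, X\<^sup>*)\<parallel> = sup {\<bar>p(z, cnj z)\<bar> | z in the spectrum}\<close>, exactly one such \<open>Y\<close> exists and it does
  not depend on the approximating sequence.\<close>

definition has_functional_calculus ::
    "('h::chilbert_space \<Rightarrow> 'h) \<Rightarrow> (complex \<Rightarrow> complex) \<Rightarrow> ('h \<Rightarrow> 'h) \<Rightarrow> bool" where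
  "has_functional_calculus X f Y \<longleftrightarrow> bounded_clinear Y \<and>
     (\<exists>d a. uniform_limit (op_spectrum X) (\<lambda>n. star_poly (d n) (a n)) f sequentially \<and>
            (\<lambda>n. onorm (\<lambda>v. star_poly_op (d n) (a n) X v - Y v)) \<longlonglongrightarrow> 0)"

definition cb_algebra :: "('h::chilbert_space \<Rightarrow> 'h) \<Rightarrow> ('h \<Rightarrow> 'h) set" where
  "cb_algebra X = {Y. \<exists>f. continuous_on UNIV f \<and> bounded (range f) \<and> f 0 = 0 \<and>
     has_functional_calculus X f Y}"

definition vector_state :: "'h::complex_inner \<Rightarrow> ('h \<Rightarrow> 'h) \<Rightarrow> complex" where
  "vector_state \<xi> X = cinner \<xi> (X \<xi>)"

abbreviation op_prod :: "('h \<Rightarrow> 'h) list \<Rightarrow> 'h \<Rightarrow> 'h" where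
  "op_prod Xs \<equiv> foldr (\<circ>) Xs id"

text \<open>The lists \<open>is = [i\<^sub>1, \<dots>, i\<^sub>r]\<close> and \<open>ks = [k\<^sub>1, \<dots>, k\<^sub>s]\<close> may be empty; each is decreasing with
  last entry above \<open>j\<close>.\<close>

definition monotonically_independent ::
    "'h::chilbert_space \<Rightarrow> 'i::linorder set \<Rightarrow> ('i \<Rightarrow> ('h \<Rightarrow> 'h) set) \<Rightarrow> bool" where
  "monotonically_independent \<xi> I A \<longleftrightarrow>
     (\<forall>i\<in>I. star_subalgebra (A i)) \<and>
     (\<forall>is j ks Xs Y Zs.
        set is \<subseteq> I \<and> j \<in> I \<and> set ks \<subseteq> I \<and>
        sorted_wrt (>) (is @ [j]) \<and> sorted_wrt (>) (ks @ [j]) \<and>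
        list_all2 (\<lambda>i X. X \<in> A i) is Xs \<and> Y \<in> A j \<and> list_all2 (\<lambda>k Z. Z \<in> A k) ks Zs \<longrightarrow>
        vector_state \<xi> (op_prod (Xs @ [Y] @ rev Zs)) =
          prod_list (map (vector_state \<xi>) Xs) * vector_state \<xi> Y *
          prod_list (map (vector_state \<xi>) (rev Zs))) \<and>
     (\<forall>i\<in>I. \<forall>j\<in>I. \<forall>k\<in>I. i < j \<and> k < j \<longrightarrow>
        (\<forall>X\<in>A i. \<forall>Y\<in>A j. \<forall>Z\<in>A k.
           X \<circ> Y \<circ> Z = (\<lambda>v. vector_state \<xi> Y *\<^sub>C (X \<circ> Z) v)))"

text \<open>For the tuple \<open>(X 1, \<dots>, X n)\<close>; other values of \<open>X\<close> are ignored.\<close>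

definition monotonically_independent_tuple ::
    "'h::chilbert_space \<Rightarrow> nat \<Rightarrow> (nat \<Rightarrow> 'h \<Rightarrow> 'h) \<Rightarrow> bool" where
  "monotonically_independent_tuple \<xi> n X \<longleftrightarrow>
     (\<forall>i\<in>{1..n}. normal_operator (X i)) \<and>
     monotonically_independent \<xi> {1..n} (\<lambda>i. cb_algebra (X i))"

abbreviation unit_circle :: "complex set" where
  "unit_circle \<equiv> sphere 0 1"

text \<open>The moments determine \<open>\<mu>\<close>, and for \<open>U\<close> unitary and \<open>\<xi>\<close> a unit vector such a \<open>\<mu>\<close> exists.\<close>

definition has_distribution ::
    "'h::chilbert_space \<Rightarrow> ('h \<Rightarrow> 'h) \<Rightarrow> complex measure \<Rightarrow> bool" where
  "has_distribution \<xi> U \<mu> \<longleftrightarrow>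
     prob_space \<mu> \<and> sets \<mu> = sets (restrict_space borel unit_circle) \<and>
     (\<forall>n::nat. vector_state \<xi> (U ^^ n) = (\<integral>x. x ^ n \<partial>\<mu>))"

definition weakly_continuous_on ::
    "'p::topological_space set \<Rightarrow> ('p \<Rightarrow> complex measure) \<Rightarrow> bool" where
  "weakly_continuous_on S \<mu> \<longleftrightarrow>
     (\<forall>f::complex \<Rightarrow> complex. continuous_on unit_circle f \<longrightarrow>
        continuous_on S (\<lambda>p. \<integral>x. f x \<partial>\<mu> p))"

definition time_pairs :: "(real \<times> real) set" where
  "time_pairs = {(s, t). 0 \<le> s \<and> s \<le> t}"

text \<open>Only \<open>U t\<close> with \<open>t \<ge> 0\<close> is relevant.\<close>

definition umip :: "'h::chilbert_space \<Rightarrow> (real \<Rightarrow> 'h \<Rightarrow> 'h) \<Rightarrow> bool" where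
  "umip \<xi> U \<longleftrightarrow>
     (\<forall>t\<ge>0. unitary_operator (U t)) \<and> U 0 = id \<and>
     (\<exists>\<mu>. (\<forall>(s, t)\<in>time_pairs. has_distribution \<xi> (inv (U s) \<circ> U t) (\<mu> (s, t))) \<and>
          weakly_continuous_on time_pairs \<mu>) \<and>
     (\<forall>(n::nat) t. (\<forall>i\<in>{1..n}. 0 \<le> t i) \<and> mono_on {1..n} t \<longrightarrow>
        monotonically_independent_tuple \<xi> n
          (\<lambda>i. if i = 1 then (\<lambda>v. U (t 1) v - v)
               else (\<lambda>v. (inv (U (t (i - 1))) \<circ> U (t i)) v - v)))"

text \<open>The operator \<open>z V / (1 - z V)\<close>.  For \<open>\<bar>z\<bar> < 1\<close> and \<open>V\<close> unitary, \<open>1 - z V\<close> is a bijection of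
  the space, so \<open>inv\<close> is its inverse operator.\<close>

definition moment_operator :: "complex \<Rightarrow> ('h::chilbert_space \<Rightarrow> 'h) \<Rightarrow> 'h \<Rightarrow> 'h" where
  "moment_operator z V = (\<lambda>v. z *\<^sub>C V v) \<circ> inv (\<lambda>v. v - z *\<^sub>C V v)"

abbreviation unit_disc :: "complex set" where
  "unit_disc \<equiv> ball 0 1"

text \<open>The chain is \<open>\<eta>\<close>, its transition mappings are \<open>H\<close>.  Maps of the disc are compared on the disc
  only; locally uniform convergence is uniform convergence on compact subsets.\<close>

definition multiplicative_Loewner_chain ::
    "(real \<Rightarrow> complex \<Rightarrow> complex) \<Rightarrow> (real \<Rightarrow> real \<Rightarrow> complex \<Rightarrow> complex) \<Rightarrow> bool" where
  "multiplicative_Loewner_chain \<eta> H \<longleftrightarrow>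
     (\<forall>t\<ge>0. \<forall>z\<in>unit_disc. \<eta> t z = H 0 t z) \<and>
     (\<forall>(s, t)\<in>time_pairs.
        H s t holomorphic_on unit_disc \<and> H s t ` unit_disc \<subseteq> unit_disc \<and> H s t 0 = 0) \<and>
     (\<forall>s\<ge>0. \<forall>z\<in>unit_disc. H s s z = z) \<and>
     (\<forall>s t u. 0 \<le> s \<and> s \<le> t \<and> t \<le> u \<longrightarrow>
        (\<forall>z\<in>unit_disc. H s u z = H s t (H t u z))) \<and>
     (\<forall>(s, t)\<in>time_pairs. \<forall>K. compact K \<and> K \<subseteq> unit_disc \<longrightarrow>
        uniform_limit K (\<lambda>(s', t'). H s' t') (H s t) (at (s, t) within time_pairs))"

end

theory Submission
  imports Defs
begin

text \<open>Let \<open>V\<close>, \<open>W\<close> be consecutive increments and \<open>r\<^sub>W(z) = 1 + \<psi>\<^sub>W(z) = \<langle>\<xi>, (1 - z W)\<^sup>-\<^sup>1 \<xi>\<rangle>\<close>,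
  so that \<open>\<eta>\<^sub>W = (r\<^sub>W - 1) / r\<^sub>W\<close>.  Unitarity gives \<open>Re r\<^sub>W > 1/2\<close> on the disc, which says exactly
  that \<open>\<eta>\<^sub>W\<close> maps the disc into itself.  Monotone independence gives \<open>X (1 - z W)\<^sup>-\<^sup>1 = r\<^sub>W(z) X\<close>
  for \<open>X = V - 1\<close>, as far as it acts on \<open>\<xi>\<close> and on the range of \<open>X\<close>.  Hence
  \<open>(1 - z V W) x = \<xi>\<close> has an explicit solution in terms of \<open>(1 - \<eta>\<^sub>W(z) V)\<^sup>-\<^sup>1 \<xi>\<close>, and pairing
  with \<open>\<xi>\<close> gives \<open>r\<^sub>V\<^sub>W(z) = r\<^sub>V(\<eta>\<^sub>W(z))\<close>.  Continuity follows from that of the moments.\<close>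

section \<open>Complex inner product spaces\<close>

lemma cinner_add_left: "cinner (x + y) z = cinner x z + cinner y z"
  by (metis cinner_commute cinner_add_right complex_cnj_add)

lemma cinner_scaleC_left: "cinner (a *\<^sub>C x) y = cnj a * cinner x y"
  by (metis cinner_commute cinner_scaleC_right complex_cnj_mult)

lemma scaleC_one: "1 *\<^sub>C x = x"
  using scaleR_scaleC[of 1 x] by simp

lemma scaleC_zero_left: "0 *\<^sub>C x = 0"
  using scaleR_scaleC[of 0 x] by simp

lemma scaleC_zero_right: "a *\<^sub>C 0 = 0"
  using scaleC_add_right[of a 0 0] by simp

lemma scaleC_minus_left: "(- a) *\<^sub>C x = - (a *\<^sub>C x)"
  using scaleC_add_left[of a "- a" x] by (simp add: scaleC_zero_left eq_neg_iff_add_eq_0 add.commute)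

lemma scaleC_minus_right: "a *\<^sub>C (- x) = - (a *\<^sub>C x)"
  using scaleC_add_right[of a x "- x"] by (simp add: scaleC_zero_right eq_neg_iff_add_eq_0 add.commute)

lemma scaleC_diff_left: "(a - b) *\<^sub>C x = a *\<^sub>C x - b *\<^sub>C x"
  using scaleC_add_left[of a "- b" x] by (simp add: scaleC_minus_left)

lemma scaleC_diff_right: "a *\<^sub>C (x - y) = a *\<^sub>C x - a *\<^sub>C y"
  using scaleC_add_right[of a x "- y"] by (simp add: scaleC_minus_right)

lemma cinner_zero_right: "cinner x 0 = 0"
  using cinner_add_right[of x 0 0] by simp

lemma cinner_minus_right: "cinner x (- y) = - cinner x y"
  using cinner_add_right[of x y "- y"] by (simp add: cinner_zero_right eq_neg_iff_add_eq_0 add.commute)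

lemma cinner_diff_right: "cinner x (y - z) = cinner x y - cinner x z"
  using cinner_add_right[of x y "- z"] by (simp add: cinner_minus_right)

lemma cinner_diff_left: "cinner (x - y) z = cinner x z - cinner y z"
  by (metis cinner_commute cinner_diff_right complex_cnj_diff)

lemma cinner_scaleR_right: "cinner x (r *\<^sub>R y) = of_real r * cinner x y"
  by (simp add: scaleR_scaleC cinner_scaleC_right)

text \<open>The class gives homogeneity of the norm for real scalars only; the complex case follows
  by computing both squared norms through \<open>cinner_self\<close>.\<close>

lemma norm_scaleC: "norm (a *\<^sub>C x) = norm a * norm x"
proof -
  have "complex_of_real ((norm (a *\<^sub>C x))\<^sup>2) = (cnj a * a) * complex_of_real ((norm x)\<^sup>2)"
    by (simp only: cinner_self[symmetric]) (simp add: cinner_scaleC_left cinner_scaleC_right)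
  also have "\<dots> = complex_of_real ((norm a * norm x)\<^sup>2)"
    using complex_norm_square[of a] by (simp add: power_mult_distrib mult.commute)
  finally have "(norm (a *\<^sub>C x))\<^sup>2 = (norm a * norm x)\<^sup>2"
    by (simp only: of_real_eq_iff)
  then show ?thesis
    by (simp add: power2_eq_iff_nonneg)
qed

lemma norm_diff_square: "(norm (x - y))\<^sup>2 = (norm x)\<^sup>2 - 2 * Re (cinner x y) + (norm y)\<^sup>2"
proof -
  have "cinner (x - y) (x - y) = cinner x x - (cinner x y + cnj (cinner x y)) + cinner y y"
    unfolding cinner_commute[of y x, symmetric] by (simp add: cinner_diff_left cinner_diff_right)
  then have "Re (cinner (x - y) (x - y)) = Re (cinner x x) - 2 * Re (cinner x y) + Re (cinner y y)"
    by simp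
  then show ?thesis by (simp only: cinner_self Re_complex_of_real)
qed

lemma norm_add_square: "(norm (x + y))\<^sup>2 = (norm x)\<^sup>2 + 2 * Re (cinner x y) + (norm y)\<^sup>2"
  using norm_diff_square[of x "- y"] by (simp add: cinner_minus_right)

text \<open>Subtract from \<open>x\<close> its orthogonal projection \<open>a *\<^sub>C y\<close>
  onto the line of \<open>y\<close> and expand the squared norm of the remainder, which is
  nonnegative.\<close>

lemma Cauchy_Schwarz_cinner: "norm (cinner x y) \<le> norm x * norm y"
proof (cases "y = 0")
  case False
  define a where "a = cinner y x / of_real ((norm y)\<^sup>2)"
  have ny: "norm y > 0" using False by simp
  have ax: "cinner x (a *\<^sub>C y) = of_real ((norm (cinner x y))\<^sup>2 / (norm y)\<^sup>2)"
    unfolding cinner_scaleC_right a_def cinner_commute[of y x] of_real_divide complex_norm_square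
    by (simp add: mult.commute)
  have na: "norm a = norm (cinner x y) / (norm y)\<^sup>2"
    unfolding a_def cinner_commute[of y x] by (simp add: norm_divide norm_power)
  have "0 \<le> (norm (x - a *\<^sub>C y))\<^sup>2" by simp
  also have "\<dots> = (norm x)\<^sup>2 - 2 * ((norm (cinner x y))\<^sup>2 / (norm y)\<^sup>2) + (norm (a *\<^sub>C y))\<^sup>2"
    by (simp add: norm_diff_square ax)
  also have "(norm (a *\<^sub>C y))\<^sup>2 = (norm (cinner x y))\<^sup>2 / (norm y)\<^sup>2"
    using ny by (simp add: norm_scaleC na power_mult_distrib power_divide field_simps)
  finally have "(norm (cinner x y))\<^sup>2 \<le> (norm x * norm y)\<^sup>2"
    using ny by (simp add: field_simps)
  then show ?thesis by (rule power2_le_imp_le) simp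
qed (simp add: cinner_zero_right)

lemma cinner_ext: "(\<And>w. cinner x w = cinner y w) \<Longrightarrow> x = y"
proof -
  assume "\<And>w. cinner x w = cinner y w"
  then have "cinner (x - y) (x - y) = 0" by (simp add: cinner_diff_left)
  then show "x = y" by (simp add: cinner_self)
qed

lemma bounded_linear_cinner_right: "bounded_linear (cinner (x::'a::complex_inner))"
  by (rule bounded_linear_intro[of _ "norm x"])
    (simp_all add: cinner_add_right cinner_scaleR_right Cauchy_Schwarz_cinner
        mult.commute[of _ "norm x"] scaleR_conv_of_real)

lemma bounded_linear_scaleC_right: "bounded_linear (\<lambda>x::'a::complex_inner. a *\<^sub>C x)"
  by (rule bounded_linear_intro[of _ "norm a"])
    (simp_all add: scaleC_add_right scaleR_scaleC scaleC_scaleC norm_scaleC mult.commute)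

lemma bounded_linear_scaleC_left: "bounded_linear (\<lambda>a. a *\<^sub>C (x::'a::complex_inner))"
  by (rule bounded_linear_intro[of _ "norm x"])
    (simp_all add: scaleC_add_left scaleR_scaleC scaleC_scaleC norm_scaleC scaleR_conv_of_real)

section \<open>The adjoint\<close>

text \<open>Minimise the strongly convex functional \<open>J x = \<parallel>x\<parallel>\<^sup>2 - 2 Re (f x)\<close>: by the parallelogram
  law a minimising sequence is Cauchy, and the first variation at the minimum represents \<open>f\<close>.\<close>

lemma Riesz_representation:
  fixes f :: "'h::chilbert_space \<Rightarrow> complex"
  assumes f: "bounded_linear f" and fC: "\<And>a x. f (a *\<^sub>C x) = a * f x"
  shows "\<exists>y. \<forall>x. f x = cinner y x"
proof -
  interpret f: bounded_linear f by fact
  define J where "J x = (norm x)\<^sup>2 - 2 * Re (f x)" for x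
  define m where "m = Inf (range J)"
  \<comment> \<open>Completing the square in \<open>norm x\<close> bounds \<open>J\<close> from
    below, so its infimum \<open>m\<close> is meaningful.\<close>
  have lower: "J x \<ge> - (onorm f)\<^sup>2" for x
  proof -
    have "Re (f x) \<le> onorm f * norm x"
      using onorm[OF f, of x] complex_Re_le_cmod[of "f x"] by linarith
    moreover have "(norm x - onorm f)\<^sup>2 \<ge> 0" by simp
    ultimately show ?thesis by (simp add: J_def power2_eq_square algebra_simps)
  qed
  then have bdd: "bdd_below (range J)" by (intro bdd_belowI2[of _ "- (onorm f)\<^sup>2"]) auto
  have m: "m \<le> J x" for x unfolding m_def by (rule cInf_lower[OF _ bdd]) simp
  \<comment> \<open>The midpoint of \<open>x\<close> and \<open>y\<close> also has
    \<open>J\<close>-value at least \<open>m\<close>, which forces two near-minimisers to be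
    close.\<close>
  have parallelogram: "(norm (x - y))\<^sup>2 \<le> 2 * (J x - m) + 2 * (J y - m)" for x y
  proof -
    have "J ((1/2) *\<^sub>R (x + y)) = (norm (x + y) / 2)\<^sup>2 - Re (f x) - Re (f y)"
      unfolding J_def norm_scaleR f.scaleR f.add by (simp add: field_simps)
    then have "4 * J ((1/2) *\<^sub>R (x + y)) = (norm (x + y))\<^sup>2 - 4 * Re (f x) - 4 * Re (f y)"
      by (simp add: power_divide)
    then have "(norm (x - y))\<^sup>2 = 2 * J x + 2 * J y - 4 * J ((1/2) *\<^sub>R (x + y))"
      by (simp add: J_def norm_add_square norm_diff_square)
    with m[of "(1/2) *\<^sub>R (x + y)"] show ?thesis by simp
  qed
  have "\<exists>x. J x < m + inverse (real (Suc n))" for n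
    using cInf_less_iff[OF _ bdd, of "m + inverse (real (Suc n))"] by (auto simp: m_def)
  then obtain x where x: "\<And>n. J (x n) < m + inverse (real (Suc n))" by metis
  have "Cauchy x"
  proof (rule metric_CauchyI)
    fix e :: real assume e: "e > 0"
    then obtain N where N: "inverse (real (Suc N)) < e\<^sup>2 / 4"
      using reals_Archimedean[of "e\<^sup>2 / 4"] by auto
    have small: "J (x n) - m < e\<^sup>2 / 4" if "n \<ge> N" for n
    proof -
      have "inverse (real (Suc n)) \<le> inverse (real (Suc N))" using that by (simp add: le_imp_inverse_le)
      then show ?thesis using x[of n] N by linarith
    qed
    have "dist (x i) (x k) < e" if "i \<ge> N" "k \<ge> N" for i k
    proof -
      have "(norm (x i - x k))\<^sup>2 < e\<^sup>2"
        using parallelogram[of "x i" "x k"] add_strict_mono[OF small[OF that(1)] small[OF that(2)]]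
        by (simp add: field_simps)
      then show ?thesis using e by (simp add: dist_norm power2_less_imp_less)
    qed
    then show "\<exists>M. \<forall>i\<ge>M. \<forall>k\<ge>M. dist (x i) (x k) < e" by blast
  qed
  then obtain y where y: "x \<longlonglongrightarrow> y" using Cauchy_convergent convergent_def by blast
  have "(\<lambda>n. J (x n)) \<longlonglongrightarrow> J y"
    unfolding J_def by (intro tendsto_intros f.tendsto y)
  moreover have "(\<lambda>n. m + inverse (real (Suc n))) \<longlonglongrightarrow> m + 0"
    by (intro tendsto_intros LIMSEQ_inverse_real_of_nat)
  ultimately have "J y \<le> m + 0" by (rule LIMSEQ_le) (use x less_imp_le in blast)
  then have min: "J y \<le> J x" for x using m[of x] by linarith
  have Re: "Re (f h) = Re (cinner y h)" for h
  proof (rule ccontr)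
    define d where "d = Re (cinner y h) - Re (f h)"
    assume "\<not> ?thesis"
    then have d: "d \<noteq> 0" by (simp add: d_def)
    have h: "0 \<le> 2 * t * d + t\<^sup>2 * (norm h)\<^sup>2" for t
      using min[of "y + t *\<^sub>R h"]
      unfolding J_def norm_add_square f.add f.scaleR cinner_scaleR_right
      by (simp add: power_mult_distrib d_def algebra_simps)
    have "h \<noteq> 0" using d by (auto simp: d_def cinner_zero_right f.zero)
    then have pos: "(norm h)\<^sup>2 > 0" by simp
    \<comment> \<open>The quadratic in \<open>t\<close> is evaluated at its vertex, where it is
      negative because \<open>d\<close> is nonzero; this contradicts minimality of
      \<open>y\<close>.\<close>
    have "2 * (- d / (norm h)\<^sup>2) * d + (- d / (norm h)\<^sup>2)\<^sup>2 * (norm h)\<^sup>2 = - (d\<^sup>2 / (norm h)\<^sup>2)"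
      using pos unfolding power2_eq_square[of "- d / _"] power2_eq_square[of d] by (simp add: field_simps)
    then have "d\<^sup>2 / (norm h)\<^sup>2 \<le> 0" using h[of "- d / (norm h)\<^sup>2"] by linarith
    moreover have "d\<^sup>2 / (norm h)\<^sup>2 > 0" using pos d by simp
    ultimately show False by linarith
  qed
  have "f h = cinner y h" for h
  proof (rule complex_eqI)
    \<comment> \<open>The real part at \<open>\<i> *\<^sub>C h\<close> is minus the imaginary part
      at \<open>h\<close>, for both functionals.\<close>
    have "Re (f (\<i> *\<^sub>C h)) = Re (cinner y (\<i> *\<^sub>C h))" by (rule Re)
    then show "Im (f h) = Im (cinner y h)" by (simp add: fC cinner_scaleC_right)
  qed (rule Re)
  then show ?thesis by blast
qed

lemma bounded_clinear_bounded_linear: "bounded_clinear X \<Longrightarrow> bounded_linear X"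
  and bounded_clinear_scaleC: "bounded_clinear X \<Longrightarrow> X (a *\<^sub>C v) = a *\<^sub>C X v"
  by (simp_all add: bounded_clinear_def)

text \<open>\<open>cadjoint\<close> is a definite description. Nondegeneracy of the inner product
  supplies uniqueness, so an adjoint can be identified by exhibiting it.\<close>

lemma cadjoint_eqI:
  assumes "\<And>v w. cinner (Y v) w = cinner v (X w)"
  shows "cadjoint X = Y"
  unfolding cadjoint_def
proof (rule the_equality)
  fix Z assume "\<forall>v w. cinner (Z v) w = cinner v (X w)"
  then have "cinner (Z v) w = cinner (Y v) w" for v w using assms by simp
  then show "Z = Y" by (intro ext cinner_ext)
qed (use assms in simp)

text \<open>Existence of the adjoint: for each \<open>v\<close>, Riesz representation is applied to
  the functional sending \<open>w\<close> to \<open>cinner v (X w)\<close>.\<close>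

lemma cinner_cadjoint_left:
  fixes X :: "'h::chilbert_space \<Rightarrow> 'h"
  assumes X: "bounded_clinear X"
  shows "cinner (cadjoint X v) w = cinner v (X w)"
proof -
  have "\<exists>y. \<forall>w. cinner v (X w) = cinner y w" for v
    using X by (intro Riesz_representation bounded_linear_compose[OF bounded_linear_cinner_right, of X v])
      (simp_all add: bounded_clinear_def cinner_scaleC_right)
  then obtain Y where Y: "\<And>v w. cinner (Y v) w = cinner v (X w)" by metis
  then have "cadjoint X = Y" by (rule cadjoint_eqI)
  with Y show ?thesis by simp
qed

lemma cinner_cadjoint_right:
  fixes X :: "'h::chilbert_space \<Rightarrow> 'h"
  assumes "bounded_clinear X"
  shows "cinner v (cadjoint X w) = cinner (X v) w"
  by (metis assms cinner_cadjoint_left cinner_commute)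

lemma cadjoint_cadjoint:
  fixes X :: "'h::chilbert_space \<Rightarrow> 'h"
  assumes "bounded_clinear X"
  shows "cadjoint (cadjoint X) = X"
  by (rule cadjoint_eqI) (simp add: assms cinner_cadjoint_right)

section \<open>Unitary operators: isometry, adjoints, products and inverses\<close>

lemma unitary_operator_bounded_clinear: "unitary_operator U \<Longrightarrow> bounded_clinear U"
  and cadjoint_unitary: "unitary_operator U \<Longrightarrow> cadjoint U (U v) = v"
  and unitary_cadjoint: "unitary_operator U \<Longrightarrow> U (cadjoint U v) = v"
  by (auto simp: unitary_operator_def fun_eq_iff)

lemma norm_unitary_operator:
  assumes U: "unitary_operator U"
  shows "norm (U v) = norm v"
proof -
  have "cinner (U v) (U v) = cinner v v"
    using cinner_cadjoint_left[OF unitary_operator_bounded_clinear[OF U], of "U v" v]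
    by (simp add: cadjoint_unitary[OF U])
  then have "(norm (U v))\<^sup>2 = (norm v)\<^sup>2" by (simp only: cinner_self of_real_eq_iff)
  then show ?thesis by simp
qed

text \<open>Linearity of the adjoint is checked by pairing with arbitrary vectors; boundedness holds
  because \<open>U\<close> is isometric and undoes its adjoint.\<close>

lemma unitary_operator_cadjoint:
  fixes U :: "'h::chilbert_space \<Rightarrow> 'h"
  assumes U: "unitary_operator U"
  shows "unitary_operator (cadjoint U)"
proof -
  note bU = unitary_operator_bounded_clinear[OF U]
  have add: "cadjoint U (x + y) = cadjoint U x + cadjoint U y" for x y
    by (rule cinner_ext) (simp add: bU cinner_cadjoint_left cinner_add_left)
  have scale: "cadjoint U (a *\<^sub>C x) = a *\<^sub>C cadjoint U x" for a x
    by (rule cinner_ext) (simp add: bU cinner_cadjoint_left cinner_scaleC_left)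
  have "norm (cadjoint U x) = norm x" for x
    using norm_unitary_operator[OF U, of "cadjoint U x"] by (simp add: unitary_cadjoint[OF U])
  then have "bounded_linear (cadjoint U)"
    by (intro bounded_linear_intro[of _ 1]) (simp_all add: add scale scaleR_scaleC)
  with scale have "bounded_clinear (cadjoint U)" by (simp add: bounded_clinear_def)
  with U show ?thesis by (simp add: unitary_operator_def cadjoint_cadjoint[OF bU])
qed

lemma unitary_operator_comp:
  fixes U V :: "'h::chilbert_space \<Rightarrow> 'h"
  assumes U: "unitary_operator U" and V: "unitary_operator V"
  shows "unitary_operator (U \<circ> V)"
proof -
  note b = unitary_operator_bounded_clinear[OF U] unitary_operator_bounded_clinear[OF V]
  have "cadjoint (U \<circ> V) = cadjoint V \<circ> cadjoint U"
    by (rule cadjoint_eqI) (simp add: b cinner_cadjoint_left)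
  moreover have "bounded_clinear (U \<circ> V)"
    using b bounded_linear_compose[of U V] by (simp add: bounded_clinear_def o_def)
  ultimately show ?thesis
    by (simp add: unitary_operator_def fun_eq_iff cadjoint_unitary[OF U] cadjoint_unitary[OF V]
        unitary_cadjoint[OF U] unitary_cadjoint[OF V])
qed

text \<open>Bridges the two ways of writing increments: \<open>umip\<close> uses \<open>inv\<close>,
  while \<psi> uses the adjoint.\<close>

lemma inv_unitary_operator: "unitary_operator U \<Longrightarrow> inv U = cadjoint U"
  by (rule inv_unique_comp) (simp_all add: unitary_operator_def)

section \<open>The resolvent of a unitary operator\<close>

instance chilbert_space \<subseteq> banach ..

text \<open>The Neumann series of the inverse of 1 - z V. As a power series in \<open>z\<close>, it
  exposes the moments of \<open>V\<close> directly.\<close>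

definition op_resolvent :: "complex \<Rightarrow> ('h::chilbert_space \<Rightarrow> 'h) \<Rightarrow> 'h \<Rightarrow> 'h" where
  "op_resolvent z V v = (\<Sum>n. z ^ n *\<^sub>C (V ^^ n) v)"

lemma norm_funpow_unitary: "unitary_operator V \<Longrightarrow> norm ((V ^^ n) v) = norm v"
  by (induction n) (simp_all add: norm_unitary_operator)

lemma op_resolvent_sums:
  assumes "unitary_operator V" "norm z < 1"
  shows "(\<lambda>n. z ^ n *\<^sub>C (V ^^ n) v) sums op_resolvent z V v"
proof -
  have "summable (\<lambda>n. norm z ^ n * norm v)"
    using assms(2) by (intro summable_mult2 summable_geometric) simp
  then have "summable (\<lambda>n. norm (z ^ n *\<^sub>C (V ^^ n) v))"
    by (simp add: norm_scaleC norm_power norm_funpow_unitary[OF assms(1)])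
  then show ?thesis
    unfolding op_resolvent_def by (rule summable_sums[OF summable_norm_cancel])
qed

text \<open>Applying z V shifts the Neumann series by one place, so the difference is its term of
  index 0.\<close>

lemma op_resolvent_equation:
  assumes V: "unitary_operator V" and z: "norm z < 1"
  shows "op_resolvent z V v - z *\<^sub>C V (op_resolvent z V v) = v"
proof -
  note bV = unitary_operator_bounded_clinear[OF V]
  have "bounded_linear (\<lambda>x. z *\<^sub>C V x)"
    by (rule bounded_linear_compose[OF bounded_linear_scaleC_right bounded_clinear_bounded_linear[OF bV]])
  from bounded_linear.sums[OF this op_resolvent_sums[OF V z]]
  have "(\<lambda>n. z ^ Suc n *\<^sub>C (V ^^ Suc n) v) sums (z *\<^sub>C V (op_resolvent z V v))"
    by (simp add: bounded_clinear_scaleC[OF bV] scaleC_scaleC)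
  moreover have "(\<lambda>n. z ^ Suc n *\<^sub>C (V ^^ Suc n) v) sums (op_resolvent z V v - v)"
    using op_resolvent_sums[OF V z, of v] by (subst sums_Suc_iff) (simp add: scaleC_one)
  ultimately have "z *\<^sub>C V (op_resolvent z V v) = op_resolvent z V v - v"
    by (rule sums_unique2)
  then show ?thesis by simp
qed

text \<open>The difference \<open>d\<close> of two solutions satisfies
  \<open>z *\<^sub>C V d = d\<close>; since \<open>V\<close> is isometric and |z| < 1, it vanishes.
  Resolvents can thus be computed by guessing a solution.\<close>

lemma op_resolvent_unique:
  fixes V :: "'h::chilbert_space \<Rightarrow> 'h"
  assumes V: "unitary_operator V" and z: "norm z < 1" and x: "x - z *\<^sub>C V x = v"
  shows "op_resolvent z V v = x"
proof -
  interpret V: bounded_linear V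
    using V by (intro bounded_clinear_bounded_linear unitary_operator_bounded_clinear)
  define d where "d = op_resolvent z V v - x"
  have "b = a - c" if "a - b = c" for a b c :: 'h using that by auto
  from this[OF op_resolvent_equation[OF V z, of v]] this[OF x] have "z *\<^sub>C V d = d"
    by (simp add: d_def V.diff scaleC_diff_right)
  then have "norm z * norm d = norm d"
    using norm_scaleC[of z "V d"] by (simp add: norm_unitary_operator[OF V])
  then have "d = 0" using z by auto
  then show ?thesis by (simp add: d_def)
qed

text \<open>Linearity comes from uniqueness of solutions, and the bound 1 / (1 - |z|) from the
  triangle inequality in the resolvent equation.\<close>

lemma bounded_clinear_op_resolvent:
  assumes V: "unitary_operator V" and z: "norm z < 1"
  shows "bounded_clinear (op_resolvent z V)"
proof -
  note bV = unitary_operator_bounded_clinear[OF V]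
  interpret V: bounded_linear V using bV by (rule bounded_clinear_bounded_linear)
  let ?R = "op_resolvent z V"
  note eq = op_resolvent_equation[OF V z]
  have add: "?R (v + w) = ?R v + ?R w" for v w
    using eq[of v] eq[of w]
    by (intro op_resolvent_unique[OF V z]) (simp add: V.add scaleC_add_right add_diff_add)
  have scale: "?R (a *\<^sub>C v) = a *\<^sub>C ?R v" for a v
    using arg_cong[OF eq[of v], of "scaleC a"]
    by (intro op_resolvent_unique[OF V z])
      (simp add: bounded_clinear_scaleC[OF bV] scaleC_diff_right scaleC_scaleC mult.commute)
  have "norm (?R v) \<le> norm v * (1 / (1 - norm z))" for v
  proof -
    have "norm (?R v) - norm z * norm (?R v) \<le> norm v"
      using norm_triangle_ineq2[of "?R v" "z *\<^sub>C V (?R v)"]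
      by (simp add: eq norm_scaleC norm_unitary_operator[OF V])
    then have "norm (?R v) * (1 - norm z) \<le> norm v" by (simp add: algebra_simps)
    then show ?thesis using z by (simp add: pos_le_divide_eq)
  qed
  then have "bounded_linear ?R"
    by (intro bounded_linear_intro[of _ "1 / (1 - norm z)"]) (simp_all add: add scale scaleR_scaleC)
  with scale show ?thesis by (simp add: bounded_clinear_def)
qed

text \<open>Uniqueness of solutions makes 1 - z V injective, so \<open>inv\<close> returns the
  resolvent; z V times the resolvent is the resolvent minus the identity.\<close>

lemma moment_operator_conv_resolvent:
  assumes V: "unitary_operator V" and z: "norm z < 1"
  shows "moment_operator z V v = op_resolvent z V v - v"
proof -
  have "inj (\<lambda>v. v - z *\<^sub>C V v)"
    by (rule injI) (metis op_resolvent_unique[OF V z])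
  then have "inv (\<lambda>v. v - z *\<^sub>C V v) v = op_resolvent z V v"
    by (rule inv_f_eq) (rule op_resolvent_equation[OF V z])
  then show ?thesis
    using op_resolvent_equation[OF V z, of v] by (simp add: moment_operator_def algebra_simps)
qed

lemma cinner_op_resolvent_sums:
  assumes "unitary_operator V" "norm z < 1"
  shows "(\<lambda>n. vector_state \<xi> (V ^^ n) * z ^ n) sums cinner \<xi> (op_resolvent z V \<xi>)"
  using bounded_linear.sums[OF bounded_linear_cinner_right op_resolvent_sums[OF assms], of \<xi> \<xi>]
  by (simp add: cinner_scaleC_right vector_state_def mult.commute)

text \<open>With \<open>x = (1 - z V)\<^sup>-\<^sup>1 \<xi>\<close>, comparing \<open>\<parallel>x - \<xi>\<parallel> = \<parallel>z V x\<parallel> = \<bar>z\<bar> \<parallel>x\<parallel>\<close> with the expansion of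
  \<open>\<parallel>x - \<xi>\<parallel>\<^sup>2\<close> gives \<open>2 Re \<langle>\<xi>, x\<rangle> = 1 + (1 - \<bar>z\<bar>\<^sup>2) \<parallel>x\<parallel>\<^sup>2\<close>.\<close>

lemma Re_cinner_op_resolvent:
  assumes V: "unitary_operator V" and z: "norm z < 1" and \<xi>: "norm \<xi> = 1"
  shows "Re (cinner \<xi> (op_resolvent z V \<xi>)) > 1 / 2"
proof -
  define x where "x = op_resolvent z V \<xi>"
  have eq: "x - z *\<^sub>C V x = \<xi>" unfolding x_def by (rule op_resolvent_equation[OF V z])
  have "V 0 = 0" using norm_unitary_operator[OF V, of 0] by simp
  then have "x \<noteq> 0" using eq \<xi> by (auto simp: scaleC_zero_right)
  have "x - \<xi> = z *\<^sub>C V x" using eq by (simp add: algebra_simps)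
  then have "(norm x)\<^sup>2 - 2 * Re (cinner x \<xi>) + 1 = (norm z)\<^sup>2 * (norm x)\<^sup>2"
    using norm_diff_square[of x \<xi>] \<xi>
    by (simp add: norm_scaleC norm_unitary_operator[OF V] power_mult_distrib)
  moreover have "Re (cinner x \<xi>) = Re (cinner \<xi> x)" by (subst cinner_commute) simp
  moreover have "(norm z)\<^sup>2 * (norm x)\<^sup>2 < 1 * (norm x)\<^sup>2"
    using z \<open>x \<noteq> 0\<close> by (intro mult_strict_right_mono) (simp_all add: power_less_one_iff)
  ultimately show ?thesis unfolding x_def by linarith
qed

section \<open>Increments in the algebra of continuous functions\<close>

text \<open>If |c| > 2 then |1 + c| > 1, so w = 1 / (1 + c) lies in the disc and V - 1 - c = -(1 +
  c) (1 - w V) is inverted by -w times the resolvent at \<open>w\<close>.\<close>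

lemma op_spectrum_unitary_diff_id:
  assumes V: "unitary_operator V"
  shows "op_spectrum (\<lambda>v. V v - v) \<subseteq> cball 0 2"
proof (rule subsetI, rule ccontr)
  fix c assume c: "c \<in> op_spectrum (\<lambda>v. V v - v)" "c \<notin> cball 0 2"
  have nc: "norm (1 + c) > 1" using c(2) norm_triangle_ineq4[of "1 + c" 1] by simp
  define w where "w = inverse (1 + c)"
  have w: "norm w < 1" unfolding w_def norm_inverse using nc by (simp add: inverse_less_1_iff)
  have c0: "1 + c \<noteq> 0" using nc by auto
  then have wc: "w * (1 + c) = 1" "(1 + c) * w = 1" by (simp_all add: w_def)
  define R where "R v = (- w) *\<^sub>C op_resolvent w V v" for v
  have bR: "bounded_clinear (op_resolvent w V)" by (rule bounded_clinear_op_resolvent[OF V w])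
  have "bounded_clinear R"
    using bR bounded_linear_compose[OF bounded_linear_scaleC_right, of "op_resolvent w V"]
    by (auto simp: bounded_clinear_def R_def[abs_def] scaleC_scaleC mult.commute)
  have step: "V v - v - c *\<^sub>C v = (- (1 + c)) *\<^sub>C (v - w *\<^sub>C V v)" for v
  proof -
    have "(1 + c) *\<^sub>C w *\<^sub>C V v = V v"
      by (simp only: scaleC_scaleC wc scaleC_one)
    then have "(1 + c) *\<^sub>C (v - w *\<^sub>C V v) = v + c *\<^sub>C v - V v"
      by (simp only: scaleC_diff_right scaleC_add_left scaleC_one)
    then show ?thesis by (simp only: scaleC_minus_left) simp
  qed
  have 1: "R (V v - v - c *\<^sub>C v) = v" for v
    unfolding step R_def bounded_clinear_scaleC[OF bR] scaleC_scaleC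
    by (simp only: op_resolvent_unique[OF V w refl] minus_mult_minus wc scaleC_one)
  have Veq: "V (a *\<^sub>C v) = a *\<^sub>C V v" for a v
    by (rule bounded_clinear_scaleC[OF unitary_operator_bounded_clinear[OF V]])
  have 2: "V (R v) - R v - c *\<^sub>C R v = v" for v
  proof -
    have "R v - w *\<^sub>C V (R v) = (- w) *\<^sub>C (op_resolvent w V v - w *\<^sub>C V (op_resolvent w V v))"
      by (simp add: R_def Veq scaleC_diff_right scaleC_scaleC)
    also have "\<dots> = (- w) *\<^sub>C v" by (simp only: op_resolvent_equation[OF V w])
    finally show ?thesis
      by (simp only: step scaleC_scaleC minus_mult_minus wc scaleC_one)
  qed
  have "R \<circ> (\<lambda>v. V v - v - c *\<^sub>C v) = id" "(\<lambda>v. V v - v - c *\<^sub>C v) \<circ> R = id"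
    by (simp_all only: fun_eq_iff o_apply id_apply 1 2 simp_thms)
  with c(1) \<open>bounded_clinear R\<close> show False unfolding op_spectrum_def by blast
qed

text \<open>The function representing the increment is the identity, cut off outside a disc
  containing the spectrum.\<close>

lemma unitary_diff_id_in_cb_algebra:
  assumes V: "unitary_operator V"
  shows "(\<lambda>v. V v - v) \<in> cb_algebra (\<lambda>v. V v - v)"
proof -
  let ?X = "\<lambda>v. V v - v"
  define f :: "complex \<Rightarrow> complex" where "f = closest_point (cball 0 2)"
  \<comment> \<open>These are the coefficients of the polynomial \<open>z\<close>, which serves as
    every member of the approximating sequence.\<close>
  define a :: "nat \<Rightarrow> nat \<Rightarrow> complex" where "a j k = (if j = 1 \<and> k = 0 then 1 else 0)" for j k
  have f: "f z = z" if "z \<in> cball 0 2" for z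
    unfolding f_def by (rule closest_point_self[OF that])
  have "continuous_on UNIV f"
    unfolding f_def by (intro continuous_on_closest_point) auto
  moreover have "bounded (range f)"
    by (rule bounded_subset[of "cball 0 2"]) (auto simp: f_def simp del: mem_cball intro!: closest_point_in_set)
  moreover have "bounded_clinear ?X"
    using unitary_operator_bounded_clinear[OF V]
    by (auto simp: bounded_clinear_def scaleC_diff_right intro: bounded_linear_sub bounded_linear_ident)
  moreover have "star_poly 1 a = (\<lambda>z. z)"
    by (simp add: star_poly_def a_def fun_eq_iff)
  then have "uniform_limit (op_spectrum ?X) (\<lambda>n. star_poly 1 a) f sequentially"
    using op_spectrum_unitary_diff_id[OF V] f by (auto intro!: uniform_limitI simp: subset_iff)
  moreover have "star_poly_op 1 a ?X v = ?X v" for v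
    by (simp add: star_poly_op_def a_def scaleC_zero_left scaleC_one)
  then have "(\<lambda>n::nat. onorm (\<lambda>v. star_poly_op 1 a ?X v - ?X v)) \<longlonglongrightarrow> 0"
    by (simp add: onorm_zero)
  ultimately show ?thesis
    unfolding cb_algebra_def has_functional_calculus_def using f[of 0]
    by (intro CollectI exI[of _ f] conjI exI[of _ "\<lambda>n. 1"] exI[of _ "\<lambda>n. a"]) auto
qed

section \<open>Consequences of monotone independence\<close>

text \<open>The subalgebras may lack the identity, so powers enter only after subtracting it. With X
  = W - 1 and Y = W^n - 1, the induction uses X Y + X + Y = W^(n+1) - 1.\<close>

lemma funpow_diff_id_in_star_subalgebra:
  assumes A: "star_subalgebra A" and W: "bounded_clinear W" and mem: "(\<lambda>v. W v - v) \<in> A"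
  shows "(\<lambda>v. (W ^^ n) v - v) \<in> A"
proof (induction n)
  case 0
  then show ?case using A by (simp add: star_subalgebra_def)
next
  case (Suc n)
  interpret W: bounded_linear W using W by (rule bounded_clinear_bounded_linear)
  let ?X = "\<lambda>v. W v - v" and ?Y = "\<lambda>v. (W ^^ n) v - v"
  have add: "(\<lambda>v. P v + Q v) \<in> A" "P \<circ> Q \<in> A" if "P \<in> A" "Q \<in> A" for P Q
    using A that by (auto simp: star_subalgebra_def)
  have "(\<lambda>v. (?X \<circ> ?Y) v + (?X v + ?Y v)) \<in> A"
    by (intro add mem Suc)
  moreover have "(\<lambda>v. (?X \<circ> ?Y) v + (?X v + ?Y v)) = (\<lambda>v. (W ^^ Suc n) v - v)"
    by (simp add: W.diff fun_eq_iff)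
  ultimately show ?case by simp
qed

text \<open>Condition (i) evaluates \<open>\<Phi>(Y\<^sup>* X\<^sup>* X Y)\<close>, \<open>\<Phi>(Y\<^sup>* X\<^sup>* X)\<close> and \<open>\<Phi>(X\<^sup>* X Y)\<close>, which shows
  \<open>\<parallel>X Y \<xi> - \<Phi>(Y) X \<xi>\<parallel> = 0\<close>.\<close>

lemma monotonically_independent_vector:
  assumes ind: "monotonically_independent \<xi> I A" and ij: "i \<in> I" "j \<in> I" "i < j"
    and X: "X \<in> A i" and Y: "Y \<in> A j"
  shows "X (Y \<xi>) = vector_state \<xi> Y *\<^sub>C X \<xi>"
proof -
  have star: "star_subalgebra (A i)" "star_subalgebra (A j)"
    using ind ij by (auto simp: monotonically_independent_def)
  then have b: "bounded_clinear X" "bounded_clinear Y"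
    using X Y by (auto simp: star_subalgebra_def)
  define Z where "Z = cadjoint X \<circ> X"
  have Z: "Z \<in> A i" and Y': "cadjoint Y \<in> A j"
    using star X Y by (auto simp: star_subalgebra_def Z_def)
  have prod: "vector_state \<xi> (op_prod (Xs @ [Z] @ rev Zs)) =
          prod_list (map (vector_state \<xi>) Xs) * vector_state \<xi> Z *
          prod_list (map (vector_state \<xi>) (rev Zs))"
    if "list_all2 (\<lambda>i X. X \<in> A i) is Xs" "list_all2 (\<lambda>i X. X \<in> A i) ks Zs"
      "set is \<subseteq> I" "set ks \<subseteq> I" "sorted_wrt (>) (is @ [i])" "sorted_wrt (>) (ks @ [i])"
    for "is" ks Xs Zs
    using ind ij that Z unfolding monotonically_independent_def by blast
  let ?y = "vector_state \<xi> Y" and ?z = "vector_state \<xi> Z"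
  have y': "vector_state \<xi> (cadjoint Y) = cnj ?y"
    unfolding vector_state_def cinner_cadjoint_right[OF b(2)] by (rule cinner_commute)
  have ZZ: "cinner (X v) (X w) = cinner v (Z w)" for v w
    by (simp add: Z_def cinner_cadjoint_right[OF b(1)])
  \<comment> \<open>In each product \<open>Z\<close> sits at the lowest index \<open>i\<close>, with
    at most one factor from \<open>A j\<close> on either side.\<close>
  have "cinner (X (Y \<xi>)) (X (Y \<xi>)) = cnj ?y * ?z * ?y"
    using prod[of "[j]" "[cadjoint Y]" "[j]" "[Y]"] ij Y Y'
    by (simp add: ZZ y'[symmetric]) (simp add: vector_state_def cinner_cadjoint_right[OF b(2)])
  moreover have "cinner (X (Y \<xi>)) (X \<xi>) = cnj ?y * ?z"
    using prod[of "[j]" "[cadjoint Y]" "[]" "[]"] ij Y'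
    by (simp add: ZZ y'[symmetric]) (simp add: vector_state_def cinner_cadjoint_right[OF b(2)])
  moreover have "cinner (X \<xi>) (X (Y \<xi>)) = ?z * ?y"
    using prod[of "[]" "[]" "[j]" "[Y]"] ij Y by (simp add: ZZ) (simp add: vector_state_def)
  moreover have "cinner (X \<xi>) (X \<xi>) = ?z" by (simp add: ZZ vector_state_def)
  ultimately have "cinner (X (Y \<xi>) - ?y *\<^sub>C X \<xi>) (X (Y \<xi>) - ?y *\<^sub>C X \<xi>) = 0"
    by (simp add: cinner_diff_left cinner_diff_right cinner_scaleC_left cinner_scaleC_right)
  then show ?thesis by (simp add: cinner_self)
qed

text \<open>The dual of the preceding lemma, obtained by moving both operators to the left argument
  and applying it to their adjoints.\<close>

lemma monotonically_independent_covector: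
  assumes ind: "monotonically_independent \<xi> I A" and ij: "i \<in> I" "j \<in> I" "i < j"
    and X: "X \<in> A i" and Y: "Y \<in> A j"
  shows "cinner \<xi> (Y (X v)) = vector_state \<xi> Y * cinner \<xi> (X v)"
proof -
  have star: "star_subalgebra (A i)" "star_subalgebra (A j)"
    using ind ij by (auto simp: monotonically_independent_def)
  then have b: "bounded_clinear X" "bounded_clinear Y"
    and adj: "cadjoint X \<in> A i" "cadjoint Y \<in> A j"
    using X Y by (auto simp: star_subalgebra_def)
  have "cinner \<xi> (Y (X v)) = cinner (cadjoint X (cadjoint Y \<xi>)) v"
    by (simp add: b cinner_cadjoint_left)
  also have "\<dots> = cnj (vector_state \<xi> (cadjoint Y)) * cinner \<xi> (X v)"
    by (simp add: monotonically_independent_vector[OF ind ij adj] cinner_scaleC_left cinner_cadjoint_left b)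
  also have "cnj (vector_state \<xi> (cadjoint Y)) = vector_state \<xi> Y"
    unfolding vector_state_def cinner_cadjoint_right[OF b(2)] by (rule cinner_commute[symmetric])
  finally show ?thesis .
qed

text \<open>The half-plane Re r > 1/2 consists of the points closer to 1 than to 0.\<close>

lemma norm_Cayley_less_one:
  assumes "Re r > 1 / 2"
  shows "norm ((r - 1) / r) < 1"
proof -
  have "(norm (r - 1))\<^sup>2 < (norm r)\<^sup>2"
    unfolding cmod_power2 using assms by (simp add: power2_eq_square algebra_simps)
  then have "norm (r - 1) < norm r" by (rule power2_less_imp_less) simp
  moreover have "r \<noteq> 0" using assms by auto
  ultimately show ?thesis by (simp add: norm_divide)
qed

text \<open>Since W^n - 1 lies in \<open>A j\<close>, independence replaces each power W^n in the
  Neumann series by its moment; summation turns the resolvent into the scalar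
  \<open>r\<close>.\<close>

lemma monotonically_independent_resolvent:
  assumes \<xi>: "norm \<xi> = 1" and ind: "monotonically_independent \<xi> I A"
    and ij: "i \<in> I" "j \<in> I" "i < j"
    and W: "unitary_operator W" "(\<lambda>v. W v - v) \<in> A j"
    and z: "norm z < 1" and X: "X \<in> A i"
  defines "r \<equiv> cinner \<xi> (op_resolvent z W \<xi>)"
  shows "X (op_resolvent z W \<xi>) = r *\<^sub>C X \<xi>"
    and "Z \<in> A i \<Longrightarrow> X (op_resolvent z W (Z v)) = r *\<^sub>C X (Z v)"
    and "cinner \<xi> (op_resolvent z W (X v)) = r * cinner \<xi> (X v)"
proof -
  have star: "star_subalgebra (A i)" "star_subalgebra (A j)"
    using ind ij by (auto simp: monotonically_independent_def)
  have bX: "bounded_clinear X" using star(1) X by (simp add: star_subalgebra_def)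
  interpret X: bounded_linear X using bX by (rule bounded_clinear_bounded_linear)
  define m where "m n = vector_state \<xi> (W ^^ n)" for n
  define Y where "Y n v = (W ^^ n) v - v" for n v
  have Y: "Y n \<in> A j" for n
    using funpow_diff_id_in_star_subalgebra[OF star(2) unitary_operator_bounded_clinear[OF W(1)] W(2)]
    by (simp add: Y_def[abs_def])
  have W_eq: "(W ^^ n) v = Y n v + v" for n v by (simp add: Y_def)
  have m_eq: "m n = vector_state \<xi> (Y n) + 1" for n
    by (simp add: m_def vector_state_def W_eq cinner_add_right cinner_self \<xi>)
  have vec: "X ((W ^^ n) \<xi>) = m n *\<^sub>C X \<xi>" for n
    by (simp add: W_eq X.add m_eq monotonically_independent_vector[OF ind ij X Y] scaleC_add_left scaleC_one)
  have cov: "cinner \<xi> ((W ^^ n) (X v)) = m n * cinner \<xi> (X v)" for n v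
    by (simp add: W_eq cinner_add_right m_eq monotonically_independent_covector[OF ind ij X Y] distrib_right)
  have r: "(\<lambda>n. m n * z ^ n) sums r"
    unfolding m_def r_def by (rule cinner_op_resolvent_sums[OF W(1) z])
  note R = op_resolvent_sums[OF W(1) z]
  have vec_sums: "X (op_resolvent z W v) = r *\<^sub>C X u"
    if *: "\<And>n. X ((W ^^ n) v) = m n *\<^sub>C X u" for v u
  proof (rule sums_unique2)
    show "(\<lambda>n. (m n * z ^ n) *\<^sub>C X u) sums X (op_resolvent z W v)"
      using X.sums[OF R[of v]] by (simp add: bounded_clinear_scaleC[OF bX] * scaleC_scaleC mult.commute)
    show "(\<lambda>n. (m n * z ^ n) *\<^sub>C X u) sums (r *\<^sub>C X u)"
      by (rule bounded_linear.sums[OF bounded_linear_scaleC_left r])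
  qed
  show "X (op_resolvent z W \<xi>) = r *\<^sub>C X \<xi>" by (rule vec_sums[OF vec])
  show "X (op_resolvent z W (Z v)) = r *\<^sub>C X (Z v)" if Z: "Z \<in> A i"
  proof (rule vec_sums)
    fix n
    \<comment> \<open>Condition (ii), with the same index \<open>i\<close> on both sides of
      \<open>j\<close>.\<close>
    have "X \<circ> Y n \<circ> Z = (\<lambda>v. vector_state \<xi> (Y n) *\<^sub>C (X \<circ> Z) v)"
      using ind ij X Z Y unfolding monotonically_independent_def by blast
    then have "X (Y n (Z v)) = vector_state \<xi> (Y n) *\<^sub>C X (Z v)" by (simp add: fun_eq_iff)
    then show "X ((W ^^ n) (Z v)) = m n *\<^sub>C X (Z v)"
      by (simp add: W_eq X.add m_eq scaleC_add_left scaleC_one)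
  qed
  show "cinner \<xi> (op_resolvent z W (X v)) = r * cinner \<xi> (X v)"
  proof (rule sums_unique2)
    show "(\<lambda>n. m n * z ^ n * cinner \<xi> (X v)) sums cinner \<xi> (op_resolvent z W (X v))"
      using bounded_linear.sums[OF bounded_linear_cinner_right R, of \<xi> "X v"]
      by (simp add: cinner_scaleC_right cov mult_ac)
    show "(\<lambda>n. m n * z ^ n * cinner \<xi> (X v)) sums (r * cinner \<xi> (X v))"
      by (rule sums_mult2[OF r])
  qed
qed

text \<open>Put \<open>X = V - 1\<close>, \<open>R = (1 - z W)\<^sup>-\<^sup>1\<close> and \<open>y = r\<^sup>-\<^sup>1 (1 - w V)\<^sup>-\<^sup>1 \<xi>\<close>, so that
  \<open>y = \<xi> + (r - 1) X y\<close>.  By independence \<open>X R y = r X y\<close>, hence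
  \<open>(1 - z V W) R y = V y - X R y = r (1 - w V) y = \<xi>\<close>, and \<open>\<langle>\<xi>, R y\<rangle> = r \<langle>\<xi>, y\<rangle>\<close>.\<close>

lemma monotonically_independent_product:
  assumes \<xi>: "norm \<xi> = 1" and ind: "monotonically_independent \<xi> I A"
    and ij: "i \<in> I" "j \<in> I" "i < j"
    and V: "unitary_operator V" "(\<lambda>v. V v - v) \<in> A i"
    and W: "unitary_operator W" "(\<lambda>v. W v - v) \<in> A j"
    and z: "norm z < 1"
  defines "r \<equiv> cinner \<xi> (op_resolvent z W \<xi>)"
  shows "cinner \<xi> (op_resolvent z (V \<circ> W) \<xi>) = cinner \<xi> (op_resolvent ((r - 1) / r) V \<xi>)"
proof -
  define w where "w = (r - 1) / r"
  have r: "Re r > 1 / 2" unfolding r_def by (rule Re_cinner_op_resolvent[OF W(1) z \<xi>])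
  then have r0: "r \<noteq> 0" by auto
  have w: "norm w < 1" unfolding w_def by (rule norm_Cayley_less_one[OF r])
  have rw: "r * w = r - 1" using r0 by (simp add: w_def)
  define X where "X v = V v - v" for v
  have X: "X \<in> A i" using V(2) by (simp add: X_def[abs_def])
  note bV = unitary_operator_bounded_clinear[OF V(1)]
  interpret V: bounded_linear V using bV by (rule bounded_clinear_bounded_linear)
  define R where "R = op_resolvent z W"
  have bR: "bounded_clinear R" unfolding R_def by (rule bounded_clinear_op_resolvent[OF W(1) z])
  interpret R: bounded_linear R using bR by (rule bounded_clinear_bounded_linear)
  have bX: "bounded_clinear X"
    using ind ij X by (auto simp: monotonically_independent_def star_subalgebra_def)
  interpret X: bounded_linear X using bX by (rule bounded_clinear_bounded_linear)
  note indR = monotonically_independent_resolvent[OF \<xi> ind ij W z X, folded r_def R_def]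
  define y where "y = inverse r *\<^sub>C op_resolvent w V \<xi>"
  have ry: "r *\<^sub>C y = op_resolvent w V \<xi>" using r0 by (simp add: y_def scaleC_scaleC scaleC_one)
  have y\<xi>: "r *\<^sub>C y - (r - 1) *\<^sub>C V y = \<xi>"
    using op_resolvent_equation[OF V(1) w, of \<xi>]
    by (simp only: ry[symmetric] bounded_clinear_scaleC[OF bV] scaleC_scaleC mult.commute[of w] rw)
  have y: "y = \<xi> + (r - 1) *\<^sub>C X y"
    unfolding X_def scaleC_diff_right scaleC_diff_left scaleC_one
    unfolding y\<xi>[symmetric] scaleC_diff_left scaleC_one by simp
  have XRy: "X (R y) = r *\<^sub>C X y"
  proof -
    have "X (R y) = X (R \<xi>) + (r - 1) *\<^sub>C X (R (X y))"
      by (subst y) (simp only: R.add X.add bounded_clinear_scaleC[OF bR] bounded_clinear_scaleC[OF bX])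
    also have "\<dots> = r *\<^sub>C X \<xi> + (r - 1) *\<^sub>C r *\<^sub>C X (X y)"
      by (simp only: indR(1) indR(2)[OF X])
    also have "\<dots> = r *\<^sub>C X (\<xi> + (r - 1) *\<^sub>C X y)"
      by (simp only: X.add bounded_clinear_scaleC[OF bX] scaleC_add_right scaleC_scaleC mult.commute)
    finally show ?thesis by (simp only: y[symmetric])
  qed
  have "z *\<^sub>C W (R y) = R y - y"
    using op_resolvent_equation[OF W(1) z, of y, folded R_def] by (metis diff_diff_eq2 add_diff_cancel_left')
  then have "z *\<^sub>C (V \<circ> W) (R y) = V (R y) - V y"
    by (simp only: o_apply bounded_clinear_scaleC[OF bV, symmetric] V.diff)
  then have "R y - z *\<^sub>C (V \<circ> W) (R y) = V y - X (R y)"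
    by (simp add: X_def)
  also have "\<dots> = r *\<^sub>C y - (r - 1) *\<^sub>C V y"
    by (simp add: XRy) (simp add: X_def scaleC_diff_right scaleC_diff_left scaleC_one)
  finally have "op_resolvent z (V \<circ> W) \<xi> = R y"
    unfolding y\<xi> by (rule op_resolvent_unique[OF unitary_operator_comp[OF V(1) W(1)] z])
  moreover have "cinner \<xi> (R y) = r * cinner \<xi> y"
  proof -
    \<comment> \<open>The equation for \<open>y\<close> is substituted as before; the term with
      \<open>X y\<close> now falls under the third claim on resolvents.\<close>
    have "cinner \<xi> (R y) = cinner \<xi> (R \<xi>) + (r - 1) * cinner \<xi> (R (X y))"
      by (subst y) (simp only: R.add bounded_clinear_scaleC[OF bR] cinner_add_right cinner_scaleC_right)
    also have "cinner \<xi> (R \<xi>) = r" by (simp add: R_def r_def)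
    also have "r + (r - 1) * cinner \<xi> (R (X y)) = r * (cinner \<xi> \<xi> + (r - 1) * cinner \<xi> (X y))"
      by (simp add: indR(3) cinner_self \<xi> distrib_left)
    also have "\<dots> = r * cinner \<xi> (\<xi> + (r - 1) *\<^sub>C X y)"
      by (simp only: cinner_add_right cinner_scaleC_right)
    finally show ?thesis by (simp only: y[symmetric])
  qed
  ultimately show ?thesis
    by (simp add: w_def[symmetric] ry[symmetric] cinner_scaleC_right)
qed

section \<open>Increments of the process\<close>

definition increment :: "(real \<Rightarrow> 'h::chilbert_space \<Rightarrow> 'h) \<Rightarrow> real \<times> real \<Rightarrow> 'h \<Rightarrow> 'h" where
  "increment U p = cadjoint (U (fst p)) \<circ> U (snd p)"

lemma unitary_increment:
  assumes "umip \<xi> U" "p \<in> time_pairs"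
  shows "unitary_operator (increment U p)"
  using assms unfolding increment_def
  by (intro unitary_operator_comp unitary_operator_cadjoint) (auto simp: umip_def time_pairs_def)

text \<open>This factorisation reduces the composition law of the transition mappings to products of
  independent increments.\<close>

lemma increment_comp:
  assumes "umip \<xi> U" "0 \<le> t"
  shows "increment U (s, u) = increment U (s, t) \<circ> increment U (t, u)"
proof -
  have "unitary_operator (U t)" using assms by (simp add: umip_def)
  then show ?thesis by (simp add: increment_def fun_eq_iff unitary_cadjoint)
qed

lemma increment_self:
  assumes "umip \<xi> U" "0 \<le> t"
  shows "increment U (t, t) = id"
proof -
  have "unitary_operator (U t)" using assms by (simp add: umip_def)
  then show ?thesis by (simp add: increment_def fun_eq_iff cadjoint_unitary)
qed

lemma increments_independent:
  assumes U: "umip \<xi> U" and stu: "0 \<le> s" "s \<le> t" "t \<le> u"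
  obtains A where "monotonically_independent \<xi> {1..3::nat} A"
    "(\<lambda>v. increment U (s, t) v - v) \<in> A 2" "(\<lambda>v. increment U (t, u) v - v) \<in> A 3"
proof -
  \<comment> \<open>The tuple for the times s, t, u begins with \<open>U s\<close> minus the
    identity, so the two wanted increments stand at positions 2 and 3.\<close>
  define \<tau> :: "nat \<Rightarrow> real" where "\<tau> i = (if i = 1 then s else if i = 2 then t else u)" for i
  define X where "X i = (if i = 1 then (\<lambda>v. U (\<tau> 1) v - v)
               else (\<lambda>v. (inv (U (\<tau> (i - 1))) \<circ> U (\<tau> i)) v - v))" for i
  have tuple: "monotonically_independent_tuple \<xi> n
      (\<lambda>i. if i = 1 then (\<lambda>v. U (t 1) v - v) else (\<lambda>v. (inv (U (t (i - 1))) \<circ> U (t i)) v - v))"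
    if "\<forall>i\<in>{1..n}. 0 \<le> t i" "mono_on {1..n} t" for n t
    using U that unfolding umip_def by (elim conjE allE[of _ n]) blast
  have "monotonically_independent_tuple \<xi> 3 X"
    unfolding X_def[abs_def] using stu by (intro tuple) (auto simp: \<tau>_def mono_on_def)
  then have ind: "monotonically_independent \<xi> {1..3} (\<lambda>i. cb_algebra (X i))"
    by (simp add: monotonically_independent_tuple_def)
  have inv: "inv (U r) = cadjoint (U r)" if "r \<ge> 0" for r
    using U that by (simp add: umip_def inv_unitary_operator)
  have p: "(s, t) \<in> time_pairs" "(t, u) \<in> time_pairs" using stu by (auto simp: time_pairs_def)
  have X: "X 2 = (\<lambda>v. increment U (s, t) v - v)" "X 3 = (\<lambda>v. increment U (t, u) v - v)"
    using stu by (simp_all add: X_def \<tau>_def increment_def inv)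
  show thesis
    using that[OF ind] unitary_diff_id_in_cb_algebra[OF unitary_increment[OF U p(1)]]
      unitary_diff_id_in_cb_algebra[OF unitary_increment[OF U p(2)]]
    unfolding X by blast
qed

text \<open>Weak continuity of the distributions, tested on the monomials
  \<open>x ^ n\<close>.\<close>

lemma increment_moments_continuous:
  assumes U: "umip \<xi> U"
  shows "continuous_on time_pairs (\<lambda>p. vector_state \<xi> (increment U p ^^ n))"
proof -
  from U obtain \<mu> where \<mu>: "\<And>s t. (s, t) \<in> time_pairs \<Longrightarrow> has_distribution \<xi> (inv (U s) \<circ> U t) (\<mu> (s, t))"
    and cont: "weakly_continuous_on time_pairs \<mu>"
    unfolding umip_def by blast
  have "continuous_on time_pairs (\<lambda>p. \<integral>x. x ^ n \<partial>\<mu> p)"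
    using cont unfolding weakly_continuous_on_def
    by (rule allE[of _ "\<lambda>x. x ^ n"]) (simp add: continuous_on_power)
  moreover have "(\<integral>x. x ^ n \<partial>\<mu> p) = vector_state \<xi> (increment U p ^^ n)" if p: "p \<in> time_pairs" for p
  proof -
    have "inv (U (fst p)) = cadjoint (U (fst p))"
      using U p by (auto simp: umip_def time_pairs_def inv_unitary_operator)
    then show ?thesis
      using \<mu>[of "fst p" "snd p"] p by (simp add: has_distribution_def increment_def)
  qed
  ultimately show ?thesis by (simp cong: continuous_on_cong)
qed

text \<open>The moments are bounded by \<open>1\<close>, so on \<open>\<bar>z\<bar> \<le> \<rho>\<close> the power series at \<open>q\<close> and \<open>p\<close> differ by at
  most \<open>\<Sum>n. \<rho>\<^sup>n \<bar>m\<^sub>n(q) - m\<^sub>n(p)\<bar>\<close>, which is continuous in \<open>q\<close> by the Weierstrass M-test.\<close>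

lemma increment_resolvent_uniform_limit:
  assumes U: "umip \<xi> U" and \<xi>: "norm \<xi> = 1" and p: "p \<in> time_pairs" and \<rho>: "0 \<le> \<rho>" "\<rho> < 1"
  shows "uniform_limit (cball 0 \<rho>) (\<lambda>q z. cinner \<xi> (op_resolvent z (increment U q) \<xi>))
    (\<lambda>z. cinner \<xi> (op_resolvent z (increment U p) \<xi>)) (at p within time_pairs)"
proof -
  define m where "m n q = vector_state \<xi> (increment U q ^^ n)" for n q
  define g where "g n q = \<rho> ^ n * norm (m n q - m n p)" for n q
  define D where "D q = (\<Sum>n. g n q)" for q
  have m_le: "norm (m n q) \<le> 1" if "q \<in> time_pairs" for n q
    using Cauchy_Schwarz_cinner[of \<xi> "(increment U q ^^ n) \<xi>"] \<xi>
    by (simp add: m_def vector_state_def norm_funpow_unitary[OF unitary_increment[OF U that]])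
  have g_le: "norm (g n q) \<le> 2 * \<rho> ^ n" if "q \<in> time_pairs" for n q
  proof -
    have "norm (m n q - m n p) \<le> 2"
      using norm_triangle_ineq4[of "m n q" "m n p"] m_le[OF that, of n] m_le[OF p, of n] by linarith
    then have "\<rho> ^ n * norm (m n q - m n p) \<le> \<rho> ^ n * 2" using \<rho> by (intro mult_left_mono) auto
    then show ?thesis using \<rho> by (simp add: g_def abs_mult)
  qed
  have summ: "summable (\<lambda>n. 2 * \<rho> ^ n)" using \<rho> by (intro summable_mult summable_geometric) simp
  have "uniform_limit time_pairs (\<lambda>N q. \<Sum>n<N. g n q) D sequentially"
    unfolding D_def using g_le summ by (rule Weierstrass_m_test)
  moreover have "continuous_on time_pairs (\<lambda>q. \<Sum>n<N. g n q)" for N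
    unfolding g_def m_def by (intro continuous_intros increment_moments_continuous[OF U])
  ultimately have "continuous_on time_pairs D"
    by (intro uniform_limit_theorem[of _ "\<lambda>N q. \<Sum>n<N. g n q"]) auto
  then have "(D \<longlongrightarrow> D p) (at p within time_pairs)" using p by (simp add: continuous_on_def)
  moreover have "D p = 0" by (simp add: D_def g_def)
  ultimately have D: "(D \<longlongrightarrow> 0) (at p within time_pairs)" by simp
  have bound: "dist (cinner \<xi> (op_resolvent z (increment U q) \<xi>)) (cinner \<xi> (op_resolvent z (increment U p) \<xi>)) \<le> D q"
    if q: "q \<in> time_pairs" and z: "z \<in> cball 0 \<rho>" for q z
  proof -
    have z1: "norm z < 1" "norm z \<le> \<rho>" using z \<rho> by auto
    have sums: "(\<lambda>n. m n q * z ^ n - m n p * z ^ n) sums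
      (cinner \<xi> (op_resolvent z (increment U q) \<xi>) - cinner \<xi> (op_resolvent z (increment U p) \<xi>))"
      unfolding m_def
      by (intro sums_diff cinner_op_resolvent_sums unitary_increment[OF U] q p z1)
    have le: "norm (m n q * z ^ n - m n p * z ^ n) \<le> g n q" for n
    proof -
      have "norm (m n q * z ^ n - m n p * z ^ n) = norm z ^ n * norm (m n q - m n p)"
        by (simp add: left_diff_distrib[symmetric] norm_mult norm_power)
      also have "\<dots> \<le> \<rho> ^ n * norm (m n q - m n p)"
        using z1 by (intro mult_right_mono power_mono) auto
      finally show ?thesis by (simp add: g_def)
    qed
    have "summable (\<lambda>n. g n q)"
      by (rule summable_comparison_test'[OF summ g_le[OF q]])
    then show ?thesis
      unfolding D_def dist_norm sums_unique[OF sums] by (rule norm_suminf_le[OF le])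
  qed
  show ?thesis
  proof (rule uniform_limitI)
    fix e :: real assume "e > 0"
    with D have "\<forall>\<^sub>F q in at p within time_pairs. D q < e" by (rule order_tendstoD)
    moreover have "\<forall>\<^sub>F q in at p within time_pairs. q \<in> time_pairs"
      by (simp add: eventually_at_filter)
    ultimately show "\<forall>\<^sub>F q in at p within time_pairs. \<forall>z\<in>cball 0 \<rho>.
      dist (cinner \<xi> (op_resolvent z (increment U q) \<xi>)) (cinner \<xi> (op_resolvent z (increment U p) \<xi>)) < e"
      by eventually_elim (use bound in fastforce)
  qed
qed

text \<open>The radius is the largest norm attained on \<open>K\<close>; an empty \<open>K\<close>
  gets radius 0.\<close>

lemma compact_subset_smaller_cball:
  fixes K :: "complex set"
  assumes "compact K" "K \<subseteq> ball 0 1"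
  obtains \<rho> where "0 \<le> \<rho>" "\<rho> < 1" "K \<subseteq> cball 0 \<rho>"
proof (cases "K = {}")
  case True
  then show ?thesis using that[of 0] by simp
next
  case False
  then obtain x where "x \<in> K" "\<forall>y\<in>K. norm y \<le> norm x"
    using continuous_attains_sup[OF assms(1) False, of norm] by (auto intro: continuous_intros)
  then show ?thesis using that[of "norm x"] assms(2) by (auto simp: subset_iff)
qed

theorem theorem5p2:
  fixes \<xi> :: "'h::chilbert_space"
    and U :: "real \<Rightarrow> 'h \<Rightarrow> 'h"
    and \<psi> \<eta> :: "real \<Rightarrow> real \<Rightarrow> complex \<Rightarrow> complex"
  assumes "norm \<xi> = 1"
    and "umip \<xi> U"
    and "\<And>s t z. 0 \<le> s \<Longrightarrow> s \<le> t \<Longrightarrow> norm z < 1 \<Longrightarrow>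
           \<psi> s t z = cinner \<xi> (moment_operator z (cadjoint (U s) \<circ> U t) \<xi>)"
    and "\<And>s t z. 0 \<le> s \<Longrightarrow> s \<le> t \<Longrightarrow> norm z < 1 \<Longrightarrow>
           \<eta> s t z = \<psi> s t z / (1 + \<psi> s t z)"
  shows "multiplicative_Loewner_chain (\<lambda>t. \<eta> 0 t) \<eta>"
proof -
  note \<xi> = assms(1) and U = assms(2)
  define r where "r p z = cinner \<xi> (op_resolvent z (increment U p) \<xi>)" for p z
  have \<eta>: "\<eta> s t z = (r (s, t) z - 1) / r (s, t) z" if "(s, t) \<in> time_pairs" "norm z < 1" for s t z
  proof -
    have "\<psi> s t z = r (s, t) z - 1"
      using assms(3)[of s t z] that moment_operator_conv_resolvent[OF unitary_increment[OF U that(1)] that(2), of \<xi>]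
      by (simp add: time_pairs_def r_def increment_def cinner_diff_right cinner_self \<xi>)
    with assms(4)[of s t z] that show ?thesis by (simp add: time_pairs_def)
  qed
  have Re: "Re (r p z) > 1 / 2" if "p \<in> time_pairs" "norm z < 1" for p z
    unfolding r_def by (rule Re_cinner_op_resolvent[OF unitary_increment[OF U that(1)] that(2) \<xi>])
  \<comment> \<open>This makes the denominator of \<eta> nonzero, so the quotients below are genuine
    divisions.\<close>
  have r0: "r p z \<noteq> 0" if "p \<in> time_pairs" "norm z < 1" for p z
    using Re[OF that] by auto
  have \<eta>_disc: "norm (\<eta> s t z) < 1" if "(s, t) \<in> time_pairs" "norm z < 1" for s t z
    unfolding \<eta>[OF that] by (rule norm_Cayley_less_one[OF Re[OF that]])
  have hol: "\<eta> s t holomorphic_on unit_disc" if p: "(s, t) \<in> time_pairs" for s t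
  proof -
    have "r (s, t) holomorphic_on unit_disc"
      unfolding r_def
      by (rule power_series_holomorphic[where a = "\<lambda>n. vector_state \<xi> (increment U (s, t) ^^ n)"])
        (simp add: cinner_op_resolvent_sums[OF unitary_increment[OF U p]])
    then have "(\<lambda>z. (r (s, t) z - 1) / r (s, t) z) holomorphic_on unit_disc"
      using r0[OF p] by (intro holomorphic_intros) auto
    then show ?thesis by (rule holomorphic_transform) (simp add: \<eta>[OF p])
  qed
  have zero: "\<eta> s t 0 = 0" if p: "(s, t) \<in> time_pairs" for s t
  proof -
    have "op_resolvent 0 (increment U (s, t)) \<xi> = \<xi>"
      by (rule op_resolvent_unique[OF unitary_increment[OF U p]]) (simp_all add: scaleC_zero_left)
    then show ?thesis by (simp add: \<eta>[OF p] r_def cinner_self \<xi>)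
  qed
  have ident: "\<eta> s s z = z" if s: "s \<ge> 0" and z: "norm z < 1" for s z
  proof -
    have p: "(s, s) \<in> time_pairs" using s by (simp add: time_pairs_def)
    have z1: "1 - z \<noteq> 0" using z by auto
    \<comment> \<open>The increment is the identity, so its resolvent at \<open>z\<close> multiplies
      by 1 / (1 - z); then r = 1 / (1 - z) and (r - 1) / r = z.\<close>
    have "op_resolvent z (increment U (s, s)) \<xi> = inverse (1 - z) *\<^sub>C \<xi>"
    proof (rule op_resolvent_unique[OF unitary_increment[OF U p] z])
      have "inverse (1 - z) *\<^sub>C \<xi> - z *\<^sub>C inverse (1 - z) *\<^sub>C \<xi> = ((1 - z) * inverse (1 - z)) *\<^sub>C \<xi>"
        by (simp only: scaleC_scaleC scaleC_diff_left[symmetric] left_diff_distrib mult_1_left)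
      then show "inverse (1 - z) *\<^sub>C \<xi> - z *\<^sub>C increment U (s, s) (inverse (1 - z) *\<^sub>C \<xi>) = \<xi>"
        using z1 by (simp add: increment_self[OF U s] scaleC_one)
    qed
    then have "r (s, s) z * (1 - z) = 1"
      using z1 by (simp add: r_def cinner_scaleC_right cinner_self \<xi>)
    then have "r (s, s) z - 1 = z * r (s, s) z"
      by (simp add: algebra_simps)
    with r0[OF p z] show ?thesis by (simp add: \<eta>[OF p z])
  qed
  have comp: "\<eta> s u z = \<eta> s t (\<eta> t u z)"
    if stu: "0 \<le> s" "s \<le> t" "t \<le> u" and z: "norm z < 1" for s t u z
  proof -
    have p: "(s, t) \<in> time_pairs" "(t, u) \<in> time_pairs" "(s, u) \<in> time_pairs"
      using stu by (auto simp: time_pairs_def)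
    obtain A where A: "monotonically_independent \<xi> {1..3::nat} A"
      "(\<lambda>v. increment U (s, t) v - v) \<in> A 2" "(\<lambda>v. increment U (t, u) v - v) \<in> A 3"
      using increments_independent[OF U stu] by blast
    \<comment> \<open>The argument (r - 1) / r in the product lemma, with \<open>r\<close> taken for
      the increment from \<open>t\<close> to \<open>u\<close>, is
      \<open>\<eta> t u z\<close>.\<close>
    have "r (s, u) z = r (s, t) (\<eta> t u z)"
      using monotonically_independent_product[OF \<xi> A(1) _ _ _ unitary_increment[OF U p(1)] A(2)
          unitary_increment[OF U p(2)] A(3) z] stu
      by (simp add: r_def \<eta>[OF p(2) z] increment_comp[OF U, of t s u])
    then show ?thesis by (simp add: \<eta>[OF p(3) z] \<eta>[OF p(1) \<eta>_disc[OF p(2) z]])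
  qed
  have unif: "uniform_limit K (\<lambda>(s', t'). \<eta> s' t') (\<eta> s t) (at (s, t) within time_pairs)"
    if p: "(s, t) \<in> time_pairs" and K: "compact K" "K \<subseteq> unit_disc" for s t K
  proof (rule uniform_limitI)
    fix e :: real assume e: "e > 0"
    obtain \<rho> where \<rho>: "0 \<le> \<rho>" "\<rho> < 1" "K \<subseteq> cball 0 \<rho>"
      using compact_subset_smaller_cball[OF K] .
    \<comment> \<open>The tolerance \<open>e / 4\<close> is chosen because \<eta> = 1 - 1 / r and
      both values of \<open>r\<close> have modulus at least 1/2, so passing from \<open>r\<close> to
      \<eta> costs a factor of at most 4.\<close>
    have "\<forall>\<^sub>F q in at (s, t) within time_pairs. \<forall>z\<in>cball 0 \<rho>. dist (r q z) (r (s, t) z) < e / 4"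
      using uniform_limitD[OF increment_resolvent_uniform_limit[OF U \<xi> p \<rho>(1,2)], of "e / 4"] e
      by (simp add: r_def)
    moreover have "\<forall>\<^sub>F q in at (s, t) within time_pairs. q \<in> time_pairs"
      by (simp add: eventually_at_filter)
    ultimately show "\<forall>\<^sub>F q in at (s, t) within time_pairs. \<forall>z\<in>K. dist ((case q of (s', t') \<Rightarrow> \<eta> s' t') z) (\<eta> s t z) < e"
    proof eventually_elim
      case (elim q)
      obtain s' t' where q: "q = (s', t')" by (cases q)
      show ?case
      proof
        fix z assume "z \<in> K"
        then have z: "norm z < 1" "z \<in> cball 0 \<rho>" using \<rho> by auto
        let ?a = "r q z" and ?b = "r (s, t) z"
        have ab: "norm ?a \<ge> 1 / 2" "norm ?b \<ge> 1 / 2"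
          using Re[OF elim(2) z(1)] Re[OF p z(1)] complex_Re_le_cmod[of ?a] complex_Re_le_cmod[of ?b] by linarith+
        then have "1 / 2 * (1 / 2) \<le> norm ?a * norm ?b" by (intro mult_mono) auto
        then have "norm (?a - ?b) / (norm ?a * norm ?b) \<le> norm (?a - ?b) / (1 / 4)"
          by (intro divide_left_mono) auto
        moreover have "\<eta> s' t' z - \<eta> s t z = (?a - ?b) / (?a * ?b)"
          using r0[OF elim(2) z(1)] r0[OF p z(1)] elim(2)
          by (simp add: q \<eta>[OF p z(1)] \<eta>[OF _ z(1)] field_simps)
        ultimately have "dist (\<eta> s' t' z) (\<eta> s t z) \<le> 4 * dist ?a ?b"
          by (simp add: dist_norm norm_divide norm_mult)
        also have "\<dots> < e" using elim(1) z(2) by fastforce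
        finally show "dist ((case q of (s', t') \<Rightarrow> \<eta> s' t') z) (\<eta> s t z) < e" by (simp add: q)
      qed
    qed
  qed
  show ?thesis
    unfolding multiplicative_Loewner_chain_def
  proof (intro conjI allI impI ballI)
    show "\<eta> s s z = z" if "0 \<le> s" "z \<in> unit_disc" for s z
      using ident that by simp
    show "\<eta> s u z = \<eta> s t (\<eta> t u z)" if "0 \<le> s \<and> s \<le> t \<and> t \<le> u" "z \<in> unit_disc" for s t u z
      by (rule comp) (use that in auto)
  qed (use hol zero \<eta>_disc unif in \<open>auto simp del: mem_ball simp: mem_ball_0\<close>)
qed

end
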